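(* For any ribbon graph $G$, the partial-dual polynomial ${}^\partial\varepsilon_G(z)=\sum_{A\subseteq E(G)} z^{\varepsilon(G^A)}$ is either an even polynomial, an odd polynomial, or both even-interpolating and odd-interpolating.
   Context: A ribbon graph $G$ is a (possibly non-orientable) surface with boundary given as a union of a set $V(G)$ of vertex discs and a set $E(G)$ of edge discs such that vertices and edges meet in disjoint line segments, each such segment lies on the boundary of exactly one vertex and exactly one edge, and each edge contains exactly two such segments. With $v(G),e(G),f(G),c(G)$ the numbers of vertices, edges, boundary components and connected components, the Euler genus is $\varepsilon(G)=2c(G)-(v(G)-e(G)+f(G))$. For $A\subseteq E(G)$, the partial dual $G^A$ is obtained by gluing a disc along each boundary component of the spanning ribbon subgraph $(V(G),A)$ (these discs become the vertices of $G^A$), removing the interiors of all vertex discs of $G$, and keeping the edge discs unchanged. For a polynomial $p(z)=\sum_i c_iz^i$, $p$ has a gap of size $k$ at $c_i$ if $c_{i-1}c_{i+k}\neq0$ and $c_i=\dots=c_{i+k-1}=0$; $p$ is interpolating if it is nonzero and has no gaps. Writing $p(z)=p_e(z^2)+z\,p_o(z^2)$ with $p_e(z^2)$ the even-degree terms and $z\,p_o(z^2)$ the odd-degree terms, $p$ is even-interpolating (resp. odd-interpolating) if $p_e(z^2)$ (resp. $p_o(z^2)$) is interpolating. An even (resp. odd) polynomial is one whose only nonzero terms have even (resp. odd) degree. *)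

theory Defs
  imports "HOL-Computational_Algebra.Polynomial"
begin

text \<open>Combinatorial model of ribbon graphs (possibly non-orientable) as graph-encoded
maps (gems): a finite set of flags with three fixed-point-free involutions t0, t1, t2
such that t0 and t2 commute and t0 t2 is fixed-point free.  Vertices are the orbits of
the group generated by t1,t2, edges the orbits of t0,t2 (four flags each), boundary
components the orbits of t0,t1, connected components the orbits of t0,t1,t2.
Edgeless vertices carry no flags and are counted by the field iso.\<close>

record 'a ribbon =
  flags :: "'a set"
  t0 :: "'a \<Rightarrow> 'a"
  t1 :: "'a \<Rightarrow> 'a"
  t2 :: "'a \<Rightarrow> 'a"
  iso :: nat

definition fpf_involution :: "'a set \<Rightarrow> ('a \<Rightarrow> 'a) \<Rightarrow> bool" where
  "fpf_involution F f \<longleftrightarrow> (\<forall>x\<in>F. f x \<in> F \<and> f (f x) = x \<and> f x \<noteq> x)"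

definition ribbon_graph :: "'a ribbon \<Rightarrow> bool" where
  "ribbon_graph G \<longleftrightarrow> finite (flags G)
     \<and> fpf_involution (flags G) (t0 G) \<and> fpf_involution (flags G) (t1 G)
     \<and> fpf_involution (flags G) (t2 G)
     \<and> (\<forall>x\<in>flags G. t0 G (t2 G x) = t2 G (t0 G x) \<and> t0 G (t2 G x) \<noteq> x)"

definition gem_rel :: "'a set \<Rightarrow> ('a \<Rightarrow> 'a) set \<Rightarrow> ('a \<times> 'a) set" where
  "gem_rel F fs = {(x, f x) | x f. x \<in> F \<and> f \<in> fs}"

definition orbits :: "'a set \<Rightarrow> ('a \<Rightarrow> 'a) set \<Rightarrow> 'a set set" where
  "orbits F fs = (\<lambda>x. {y. (x, y) \<in> (gem_rel F fs)\<^sup>*}) ` F"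

definition rg_edges :: "'a ribbon \<Rightarrow> 'a set set" where
  "rg_edges G = orbits (flags G) {t0 G, t2 G}"

definition n_vertices :: "'a ribbon \<Rightarrow> nat" where
  "n_vertices G = card (orbits (flags G) {t1 G, t2 G}) + iso G"

definition n_edges :: "'a ribbon \<Rightarrow> nat" where
  "n_edges G = card (rg_edges G)"

definition n_boundary :: "'a ribbon \<Rightarrow> nat" where
  "n_boundary G = card (orbits (flags G) {t0 G, t1 G}) + iso G"

definition n_components :: "'a ribbon \<Rightarrow> nat" where
  "n_components G = card (orbits (flags G) {t0 G, t1 G, t2 G}) + iso G"

definition euler_genus :: "'a ribbon \<Rightarrow> int" where
  "euler_genus G = 2 * int (n_components G)
     - (int (n_vertices G) - int (n_edges G) + int (n_boundary G))"

definition partial_dual :: "'a ribbon \<Rightarrow> 'a set set \<Rightarrow> 'a ribbon" where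
  "partial_dual G A = G\<lparr>
     t0 := (\<lambda>x. if x \<in> \<Union>A then t2 G x else t0 G x),
     t2 := (\<lambda>x. if x \<in> \<Union>A then t0 G x else t2 G x)\<rparr>"

definition partial_dual_poly :: "'a ribbon \<Rightarrow> int poly" where
  "partial_dual_poly G =
     (\<Sum>A\<in>Pow (rg_edges G). monom 1 (nat (euler_genus (partial_dual G A))))"

definition has_gap :: "int poly \<Rightarrow> nat \<Rightarrow> nat \<Rightarrow> bool" where
  "has_gap p i k \<longleftrightarrow> k \<ge> 1 \<and> i \<ge> 1 \<and> coeff p (i - 1) * coeff p (i + k) \<noteq> 0
     \<and> (\<forall>j. i \<le> j \<and> j < i + k \<longrightarrow> coeff p j = 0)"

definition interpolating :: "int poly \<Rightarrow> bool" where
  "interpolating p \<longleftrightarrow> p \<noteq> 0 \<and> \<not> (\<exists>i k. has_gap p i k)"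

definition even_part :: "int poly \<Rightarrow> int poly" where
  "even_part p = (\<Sum>i\<le>degree p. monom (coeff p (2 * i)) i)"

definition odd_part :: "int poly \<Rightarrow> int poly" where
  "odd_part p = (\<Sum>i\<le>degree p. monom (coeff p (2 * i + 1)) i)"

definition even_interpolating :: "int poly \<Rightarrow> bool" where
  "even_interpolating p \<longleftrightarrow> interpolating (even_part p)"

definition odd_interpolating :: "int poly \<Rightarrow> bool" where
  "odd_interpolating p \<longleftrightarrow> interpolating (odd_part p)"

definition even_poly :: "int poly \<Rightarrow> bool" where
  "even_poly p \<longleftrightarrow> (\<forall>i. odd i \<longrightarrow> coeff p i = 0)"

definition odd_poly :: "int poly \<Rightarrow> bool" where
  "odd_poly p \<longleftrightarrow> (\<forall>i. even i \<longrightarrow> coeff p i = 0)"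

end

theory Submission
  imports Defs
begin

text \<open>
  For a set \<open>A\<close> of edges let \<open>h(A)\<close> be the number of boundary circles of \<open>(V, A)\<close>; then
  \<open>\<epsilon>(G\<^sup>A) = 2c + e - h(A) - h(E - A)\<close>. Toggling one edge changes \<open>h\<close> by at most one. Orient all
  circles of \<open>A\<close>: if toggling \<open>e\<close> splits a circle, the two sides of \<open>e\<close> are oriented coherently, and
  toggling a coherent edge always changes \<open>h\<close> by exactly one and keeps the orientation valid. Hence,
  if every single edge of \<open>Y\<close> lowers \<open>\<epsilon>(G\<^sup>A)\<close> by the maximal amount 2, toggling all of \<open>Y\<close>
  preserves its parity.

  Across a gap in one parity class choose \<open>A\<close> (below) and \<open>B\<close> (above) at minimal Hamming distance.
  All sets strictly between them have the other parity. A minimal such set exceeding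
  \<open>\<epsilon>(G\<^sup>A) + 1\<close> would go down by 2 along each of its edges, contradicting the parity statement;
  so the last step to \<open>B\<close> cannot reach \<open>\<epsilon>(G\<^sup>A) + 4\<close>.
\<close>

section \<open>Orbits of a pair of involutions\<close>

text \<open>For the two involutions that trace a system of circles, a common alternating
  \<open>\<phi>\<close> is an orientation of all circles: each arc has one end of either value, so
  it tells the start of the arc from its end.\<close>

definition alternating :: "'a set \<Rightarrow> ('a \<Rightarrow> 'a) \<Rightarrow> ('a \<Rightarrow> bool) \<Rightarrow> bool" where
  "alternating F f \<phi> \<longleftrightarrow> (\<forall>x\<in>F. \<phi> (f x) = (\<not> \<phi> x))"

lemma mem_gem_rel: "(x, y) \<in> gem_rel F fs \<longleftrightarrow> x \<in> F \<and> (\<exists>f\<in>fs. y = f x)"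
  by (auto simp: gem_rel_def)

lemma gem_relI: "x \<in> F \<Longrightarrow> f \<in> fs \<Longrightarrow> (x, f x) \<in> gem_rel F fs"
  by (auto simp: gem_rel_def)

lemma gem_relE:
  assumes "(x, y) \<in> gem_rel F fs"
  obtains f where "x \<in> F" "f \<in> fs" "y = f x"
  using assms by (auto simp: gem_rel_def)

lemma sym_gem_rel:
  assumes "\<And>f x. f \<in> fs \<Longrightarrow> x \<in> F \<Longrightarrow> f x \<in> F \<and> f (f x) = x"
  shows "sym (gem_rel F fs)"
  by (rule symI) (metis assms gem_relE gem_relI)

lemma rtrancl_symD: "sym r \<Longrightarrow> (x, y) \<in> r\<^sup>* \<Longrightarrow> (y, x) \<in> r\<^sup>*"
  by (meson sym_rtrancl symD)

lemma rtrancl_closed: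
  assumes "(x, y) \<in> r\<^sup>*" "x \<in> F" "\<And>x y. (x, y) \<in> r \<Longrightarrow> x \<in> F \<Longrightarrow> y \<in> F"
  shows "y \<in> F"
  using assms(1,2) by (induction rule: rtrancl_induct) (auto intro: assms(3))

lemma funpow_closed:
  assumes "\<And>x. x \<in> F \<Longrightarrow> p x \<in> F" "x \<in> F"
  shows "(p ^^ k) x \<in> F"
  using assms by (induction k) auto

lemma funpow_comp_Suc: "((g \<circ> f) ^^ Suc k) x = g (f (((g \<circ> f) ^^ k) x))"
  by simp

lemma funpow_comp_Suc_right: "((g \<circ> f) ^^ Suc k) x = ((g \<circ> f) ^^ k) (g (f x))"
  by (metis comp_apply funpow_Suc_right)

text \<open>Cancelling the outermost \<open>g \<circ> f\<close> turns such an equation for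
  \<open>x\<close> and \<open>k\<close> into one for \<open>g (f x)\<close> and
  \<open>k - 2\<close>. The descent ends at \<open>k = 0\<close> or \<open>k = 1\<close>, that is,
  at a fixed point of \<open>f\<close> or of \<open>g\<close>.\<close>

lemma reflection_not_in_cycle:
  assumes f: "fpf_involution F f" and g: "fpf_involution F g" and "x \<in> F"
  shows "f x \<noteq> ((g \<circ> f) ^^ k) x"
  using \<open>x \<in> F\<close>
proof (induction k arbitrary: x rule: less_induct)
  case (less k)
  have cl: "f y \<in> F" "f (f y) = y" "f y \<noteq> y" "g y \<in> F" "g (g y) = y" "g y \<noteq> y" if "y \<in> F" for y
    using f g that by (auto simp: fpf_involution_def)
  consider "k = 0" | "k = 1" | j where "k = Suc (Suc j)"
    by (metis One_nat_def not0_implies_Suc)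
  then show ?case
  proof cases
    case 1
    then show ?thesis using cl less.prems by simp
  next
    case 2
    then show ?thesis using cl(1,6)[of "f x"] cl(1) less.prems by (metis comp_apply funpow_0 funpow_simps_right(2) One_nat_def)
  next
    case 3
    let ?x = "g (f x)"
    let ?z = "((g \<circ> f) ^^ j) ?x"
    have zF: "?z \<in> F"
      by (rule funpow_closed) (use cl less.prems in auto)
    have "f ?x \<noteq> ?z"
      using less.IH[of j ?x] 3 cl less.prems by (simp del: o_apply)
    moreover have "((g \<circ> f) ^^ k) x = g (f ?z)"
      unfolding 3 by (metis funpow_comp_Suc funpow_comp_Suc_right)
    ultimately show ?thesis
      using cl less.prems zF by metis
  qed
qed

text \<open>The rotations \<open>g \<circ> f\<close>, \<open>f \<circ> g\<close> split each dihedral orbit into two halves swapped by \<open>f\<close> and by \<open>g\<close>.\<close>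
lemma alternating_exists:
  assumes f: "fpf_involution F f" and g: "fpf_involution F g"
  obtains \<phi> where "alternating F f \<phi>" "alternating F g \<phi>"
proof -
  define D where "D = (gem_rel F {f, g})\<^sup>*"
  define Q where "Q = (gem_rel F {g \<circ> f, f \<circ> g})\<^sup>*"
  have cl: "f y \<in> F" "f (f y) = y" "f y \<noteq> y" "g y \<in> F" "g (g y) = y" "g y \<noteq> y" if "y \<in> F" for y
    using f g that by (auto simp: fpf_involution_def)
  have symD': "(y, x) \<in> D" if "(x, y) \<in> D" for x y
    using that unfolding D_def by (rule rtrancl_symD[rotated]) (rule sym_gem_rel, use cl in auto)
  have "sym (gem_rel F {g \<circ> f, f \<circ> g})"
  proof (rule symI)
    fix x y assume "(x, y) \<in> gem_rel F {g \<circ> f, f \<circ> g}"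
    then have "x \<in> F" "y = (g \<circ> f) x \<or> y = (f \<circ> g) x"
      by (auto elim: gem_relE)
    then have "y \<in> F" "x = (g \<circ> f) y \<or> x = (f \<circ> g) y"
      using cl by auto
    then show "(y, x) \<in> gem_rel F {g \<circ> f, f \<circ> g}"
      using gem_relI[of y F "g \<circ> f" "{g \<circ> f, f \<circ> g}"] gem_relI[of y F "f \<circ> g" "{g \<circ> f, f \<circ> g}"]
      by auto
  qed
  then have symQ: "(y, x) \<in> Q" if "(x, y) \<in> Q" for x y
    using that unfolding Q_def by (rule rtrancl_symD)
  have Qstep: "(x, g (f x)) \<in> Q" "(x, f (g x)) \<in> Q" if "x \<in> F" for x
    using gem_relI[OF that, of "g \<circ> f" "{g \<circ> f, f \<circ> g}"] gem_relI[OF that, of "f \<circ> g" "{g \<circ> f, f \<circ> g}"]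
    unfolding Q_def by (auto intro: r_into_rtrancl)
  have Qtrans: "(x, z) \<in> Q" if "(x, y) \<in> Q" "(y, z) \<in> Q" for x y z
    using that unfolding Q_def by (rule rtrancl_trans)
  have QF: "y \<in> F" if "(x, y) \<in> Q" "x \<in> F" for x y
    using that(1) unfolding Q_def
    by (rule rtrancl_closed) (use that(2) cl in \<open>auto elim!: gem_relE\<close>)
  define p where "p = g \<circ> f"
  have pS: "(p ^^ Suc k) x = g (f ((p ^^ k) x))" and pS': "(p ^^ Suc k) x = (p ^^ k) (g (f x))" for k x
    unfolding p_def by (rule funpow_comp_Suc, rule funpow_comp_Suc_right)
  \<comment> \<open>\<open>f \<circ> g\<close> undoes \<open>p\<close>, so a walk in
    \<open>Q\<close> collapses to iterates of \<open>p\<close> in one of the two directions.\<close>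
  have cyc: "(\<exists>k. y = (p ^^ k) x) \<or> (\<exists>k. x = (p ^^ k) y)" if "(x, y) \<in> Q" "x \<in> F" for x y
    using that(1) unfolding Q_def
  proof (induction rule: rtrancl_induct)
    case base
    show ?case by (rule disjI1, rule exI[of _ 0]) simp
  next
    case (step y z)
    have yF: "y \<in> F" using step.hyps(2) by (auto elim: gem_relE)
    have yz: "z = g (f y) \<or> y = g (f z)"
      using step.hyps(2) cl by (auto elim!: gem_relE)
    have zF: "z \<in> F"
      using step.hyps(2) cl by (auto elim!: gem_relE)
    have inj: "u = v" if "g (f u) = g (f v)" "u \<in> F" "v \<in> F" for u v
      using that cl by metis
    have pF: "(p ^^ k) u \<in> F" if "u \<in> F" for k u
      unfolding p_def by (rule funpow_closed) (use cl that in auto)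
    from step.IH show ?case
    proof (elim disjE exE)
      fix k assume k: "y = (p ^^ k) x"
      from yz show ?thesis
      proof
        assume "z = g (f y)"
        then show ?thesis using k by (metis pS)
      next
        assume z: "y = g (f z)"
        show ?thesis
        proof (cases k)
          case 0
          then show ?thesis using z k by (metis pS funpow_0)
        next
          case (Suc j)
          then have "z = (p ^^ j) x"
            using inj[of z "(p ^^ j) x"] z k zF pF[OF \<open>x \<in> F\<close>] pS by metis
          then show ?thesis by blast
        qed
      qed
    next
      fix k assume k: "x = (p ^^ k) y"
      from yz show ?thesis
      proof
        assume z: "z = g (f y)"
        show ?thesis
        proof (cases k)
          case 0
          then show ?thesis using z k by (metis pS funpow_0)
        next
          case (Suc j)
          then have "x = (p ^^ j) z"
            using z k pS' by metis
          then show ?thesis by blast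
        qed
      next
        assume "y = g (f z)"
        then show ?thesis using k by (metis pS')
      qed
    qed
  qed
  have not_f: "(x, f x) \<notin> Q" if "x \<in> F" for x
    using cyc[of x "f x"] reflection_not_in_cycle[OF f g, folded p_def, of x]
      reflection_not_in_cycle[OF f g, folded p_def, of "f x"] cl that by metis
  \<comment> \<open>\<open>f\<close> conjugates each of the two rotations into the other, so it maps
    classes of \<open>Q\<close> to classes of \<open>Q\<close>.\<close>
  have swap_f: "(f x, f y) \<in> Q" if "(x, y) \<in> Q" "x \<in> F" for x y
    using that(1) unfolding Q_def
  proof (induction rule: rtrancl_induct)
    case base
    show ?case by simp
  next
    case (step y z)
    have "y \<in> F" "z = g (f y) \<or> z = f (g y)"
      using step.hyps(2) by (auto elim: gem_relE)
    then have "(f y, f z) \<in> Q"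
      using Qstep[of "f y"] cl by (metis (no_types))
    with step.IH show ?case unfolding Q_def by (rule rtrancl_trans)
  qed
  have swap_g: "(f x, g y) \<in> Q" if "(x, y) \<in> Q" "x \<in> F" for x y
    using swap_f[OF that] Qstep(1)[of "f y"] QF[OF that] cl Qtrans by metis
  have halves: "(u, x) \<in> Q \<or> (f u, x) \<in> Q" if "(u, x) \<in> D" "u \<in> F" for u x
    using that(1) unfolding D_def
  proof (induction rule: rtrancl_induct)
    case base
    show ?case by (simp add: Q_def)
  next
    case (step y z)
    have "z = f y \<or> z = g y" using step.hyps(2) by (auto elim: gem_relE)
    with step.IH show ?case
      using swap_f[of u y] swap_g[of u y] swap_f[of "f u" y] swap_g[of "f u" y] that(2) cl by metis
  qed
  \<comment> \<open>The choice depends only on the class of \<open>x\<close>, so all points of one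
    dihedral orbit share a representative.\<close>
  define r where "r x = (SOME y. y \<in> D `` {x})" for x
  have r: "(r x, x) \<in> D" for x
  proof -
    have "x \<in> D `` {x}" by (simp add: D_def)
    then have "r x \<in> D `` {x}" unfolding r_def by (rule someI)
    then show ?thesis using symD' by auto
  qed
  have r_eq: "r x = r y" if "(x, y) \<in> D" for x y
  proof -
    have "D `` {x} = D `` {y}"
      using that symD'[OF that] unfolding D_def by (auto intro: rtrancl_trans)
    then show ?thesis by (simp add: r_def)
  qed
  have rF: "r x \<in> F" if "x \<in> F" for x
    using symD'[OF r[of x]] that cl unfolding D_def
    by (elim rtrancl_closed) (auto elim!: gem_relE)
  \<comment> \<open>The colour records whether \<open>x\<close> lies in the half of the
    representative or in the other one.\<close>
  define \<phi> where "\<phi> x = ((r x, x) \<in> Q)" for x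
  have key: "\<phi> (h x) = (\<not> \<phi> x)"
    if "x \<in> F" and h: "\<And>u y. (u, y) \<in> Q \<Longrightarrow> u \<in> F \<Longrightarrow> (f u, h y) \<in> Q" and hD: "(x, h x) \<in> D" for h x
  proof -
    let ?u = "r x"
    have u: "?u \<in> F" "f ?u \<in> F" "f (f ?u) = ?u" using rF[OF \<open>x \<in> F\<close>] cl by auto
    have excl: "\<not> ((?u, y) \<in> Q \<and> (f ?u, y) \<in> Q)" for y
      using not_f[OF u(1)] Qtrans symQ by blast
    have "(?u, x) \<in> Q \<or> (f ?u, x) \<in> Q" by (rule halves[OF r u(1)])
    then have "(?u, h x) \<in> Q \<longleftrightarrow> (?u, x) \<notin> Q"
      using h[of ?u x] h[of "f ?u" x] excl u by metis
    then show ?thesis by (simp add: \<phi>_def r_eq[OF hD])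
  qed
  have "(x, f x) \<in> D" "(x, g x) \<in> D" if "x \<in> F" for x
    using that unfolding D_def by (auto intro!: r_into_rtrancl gem_relI)
  then have "alternating F f \<phi>" "alternating F g \<phi>"
    unfolding alternating_def using key swap_f swap_g by metis+
  then show ?thesis by (rule that)
qed

text \<open>Walking from the fixed point \<open>a\<close> of \<open>s\<close> by \<open>f, s, f, s, \<dots>\<close> one meets a second fixed
  point first after a step by \<open>f\<close>; from there on the walk retraces itself.\<close>
lemma at_most_two_fixed_points:
  assumes f: "\<And>x. x \<in> F \<Longrightarrow> f x \<in> F \<and> f (f x) = x"
    and s: "\<And>x. x \<in> F \<Longrightarrow> s x \<in> F \<and> s (s x) = x"
    and a: "a \<in> F" "s a = a"
  shows "\<exists>u. \<forall>v. (a, v) \<in> (gem_rel F {f, s})\<^sup>* \<longrightarrow> s v = v \<longrightarrow> v = a \<or> v = u"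
proof -
  define p where "p k = ((s \<circ> f) ^^ k) a" for k
  have pF: "p k \<in> F" for k
    unfolding p_def by (rule funpow_closed) (use f s a in auto)
  have p0: "p 0 = a" and pS: "p (Suc k) = s (f (p k))" for k
    by (simp_all add: p_def)
  \<comment> \<open>The walk is \<open>p 0\<close>, \<open>f (p 0)\<close>, \<open>p 1\<close>,
    \<open>f (p 1)\<close>, ...; \<open>N k\<close> says that it meets a fixed point of
    \<open>s\<close> at \<open>f (p k)\<close>.\<close>
  define N where "N k \<longleftrightarrow> s (f (p k)) = f (p k)" for k
  \<comment> \<open>\<open>s\<close> leads from \<open>f (p j)\<close> to \<open>p (Suc j)\<close>;
    if the latter is fixed, the two coincide.\<close>
  have even_fixed: "N j" if "s (p (Suc j)) = p (Suc j)" for j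
    using that pF[of j] f s unfolding N_def pS by metis
  show ?thesis
  proof (cases "\<exists>k. N k")
    case True
    define k where "k = (LEAST k. N k)"
    have k: "N k" using True unfolding k_def by (auto intro: LeastI)
    have least: "\<not> N j" if "j < k" for j
      using that unfolding k_def by (rule not_less_Least)
    \<comment> \<open>The walk up to the first \<open>N k\<close> is closed under \<open>f\<close>
      and \<open>s\<close>, hence contains the whole orbit of \<open>a\<close>.\<close>
    define K where "K = p ` {..k} \<union> (f \<circ> p) ` {..k}"
    have "f x \<in> K \<and> s x \<in> K" if "x \<in> K" for x
    proof -
      from that consider j where "j \<le> k" "x = p j" | j where "j \<le> k" "x = f (p j)"
        unfolding K_def by auto
      then show ?thesis
      proof cases
        case 1
        then have "s x = p 0 \<or> (\<exists>i\<le>k. s x = f (p i))"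
          using a p0 pS s f pF
          by (cases j) (simp, metis Suc_leD)
        then show ?thesis using 1 unfolding K_def by auto
      next
        case 2
        have "s x \<in> K"
        proof (cases "j = k")
          case True
          then show ?thesis using 2 k unfolding N_def K_def by auto
        next
          case False
          then have "Suc j \<le> k" "s x = p (Suc j)" using 2 pS by auto
          then show ?thesis unfolding K_def by blast
        qed
        moreover have "f x \<in> K" using 2 f pF unfolding K_def by auto
        ultimately show ?thesis by simp
      qed
    qed
    then have orbit: "v \<in> K" if "(a, v) \<in> (gem_rel F {f, s})\<^sup>*" for v
      using that by (rule_tac rtrancl_closed[OF that]) (auto elim!: gem_relE simp: K_def p0[symmetric])
    have "v = a \<or> v = f (p k)" if v: "(a, v) \<in> (gem_rel F {f, s})\<^sup>*" "s v = v" for v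
    proof -
      from orbit[OF v(1)] consider j where "j \<le> k" "v = p j" | j where "j \<le> k" "v = f (p j)"
        unfolding K_def by auto
      then show ?thesis
      proof cases
        case 1
        then show ?thesis using even_fixed[of "j - 1"] least[of "j - 1"] v(2) p0 by (cases j) auto
      next
        case 2
        then have "N j" using v(2) by (simp add: N_def)
        then show ?thesis using 2 least by (metis le_neq_implies_less)
      qed
    qed
    then show ?thesis by blast
  next
    case False
    define K where "K = range p \<union> range (f \<circ> p)"
    have "f x \<in> K \<and> s x \<in> K" if "x \<in> K" for x
    proof -
      from that consider j where "x = p j" | j where "x = f (p j)"
        unfolding K_def by auto
      then show ?thesis
      proof cases
        case 1
        then have "s x = p 0 \<or> (\<exists>i. s x = f (p i))"
          using a p0 pS s f pF by (cases j) (simp, metis)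
        then show ?thesis using 1 unfolding K_def by auto
      next
        case 2
        then have "s x = p (Suc j)" "f x = p j" using pS f pF by auto
        then show ?thesis unfolding K_def by blast
      qed
    qed
    then have orbit: "v \<in> K" if "(a, v) \<in> (gem_rel F {f, s})\<^sup>*" for v
      using that by (rule_tac rtrancl_closed[OF that]) (auto elim!: gem_relE simp: K_def p0[symmetric])
    have "v = a" if v: "(a, v) \<in> (gem_rel F {f, s})\<^sup>*" "s v = v" for v
    proof -
      from orbit[OF v(1)] consider j where "v = p j" | j where "v = f (p j)"
        unfolding K_def by auto
      then show ?thesis
        using False even_fixed v(2) p0 by cases (metis N_def not0_implies_Suc)+
    qed
    then show ?thesis by blast
  qed
qed


section \<open>Components of a relation when one link is added\<close>

definition comps :: "'a set \<Rightarrow> ('a \<times> 'a) set \<Rightarrow> 'a set set" where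
  "comps F r = (\<lambda>x. {y. (x, y) \<in> r\<^sup>*}) ` F"

lemma orbits_eq_comps: "orbits F fs = comps F (gem_rel F fs)"
  by (simp add: orbits_def comps_def)

lemma comps_cong: "r\<^sup>* = r'\<^sup>* \<Longrightarrow> comps F r = comps F r'"
  by (simp add: comps_def)

text \<open>A walk through the new link can be shortened to one that crosses it at most once, in one
  of the two directions.\<close>

lemma rtrancl_insert_sym:
  assumes "sym r"
  shows "(x, y) \<in> (r \<union> {(a, b), (b, a)})\<^sup>* \<longleftrightarrow>
    (x, y) \<in> r\<^sup>* \<or> (x, a) \<in> r\<^sup>* \<and> (b, y) \<in> r\<^sup>* \<or> (x, b) \<in> r\<^sup>* \<and> (a, y) \<in> r\<^sup>*"
proof -
  have "r \<union> {(a, b), (b, a)} = insert (a, b) (insert (b, a) r)" by auto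
  then show ?thesis
    by (simp only: rtrancl_insert) (blast intro: rtrancl_trans rtrancl_symD[OF assms])
qed

text \<open>The link unites the components of \<open>a\<close> and \<open>b\<close> and leaves all
  others as they are.\<close>

lemma card_comps_insert:
  assumes "finite F" "sym r" "a \<in> F" "b \<in> F"
  shows "card (comps F r) = card (comps F (r \<union> {(a, b), (b, a)})) + (if (a, b) \<in> r\<^sup>* then 0 else 1)"
proof -
  let ?r' = "r \<union> {(a, b), (b, a)}"
  have symR: "(y, x) \<in> r\<^sup>*" if "(x, y) \<in> r\<^sup>*" for x y
    using assms(2) that by (rule rtrancl_symD)
  note R' = rtrancl_insert_sym[OF assms(2), of _ _ a b]
  show ?thesis
  proof (cases "(a, b) \<in> r\<^sup>*")
    case True
    have "(x, y) \<in> ?r'\<^sup>* \<longleftrightarrow> (x, y) \<in> r\<^sup>*" for x y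
      unfolding R' by (meson True symR rtrancl_trans)
    then have "?r'\<^sup>* = r\<^sup>*" by auto
    then show ?thesis using True comps_cong[of ?r' r F] by simp
  next
    case False
    define C where "C x = {y. (x, y) \<in> r\<^sup>*}" for x
    have C_eq: "C x = C y" if "(x, y) \<in> r\<^sup>*" for x y
      using that symR[OF that] unfolding C_def by (auto intro: rtrancl_trans)
    have mem: "x \<in> C x" for x by (simp add: C_def)
    have old: "comps F r = C ` F" by (simp add: comps_def C_def)
    have C': "{y. (x, y) \<in> ?r'\<^sup>*} = (if x \<in> C a \<union> C b then C a \<union> C b else C x)" for x
    proof (cases "x \<in> C a \<union> C b")
      case True
      then have "(x, a) \<in> r\<^sup>* \<or> (x, b) \<in> r\<^sup>*" using symR by (auto simp: C_def)
      then have "y \<in> C a \<union> C b \<longleftrightarrow> (x, y) \<in> ?r'\<^sup>*" for y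
        unfolding R' C_def by (blast intro: rtrancl_trans symR)
      then show ?thesis using True by auto
    next
      case False
      then have "(x, a) \<notin> r\<^sup>*" "(x, b) \<notin> r\<^sup>*" using symR by (auto simp: C_def)
      then show ?thesis using False unfolding R' C_def by auto
    qed
    have new: "comps F ?r' = insert (C a \<union> C b) (C ` F - {C a, C b})"
    proof
      show "comps F ?r' \<subseteq> insert (C a \<union> C b) (C ` F - {C a, C b})"
        unfolding comps_def C' using mem by auto
      show "insert (C a \<union> C b) (C ` F - {C a, C b}) \<subseteq> comps F ?r'"
      proof
        fix Z assume "Z \<in> insert (C a \<union> C b) (C ` F - {C a, C b})"
        then consider "Z = C a \<union> C b" | x where "x \<in> F" "Z = C x" "C x \<noteq> C a" "C x \<noteq> C b"
          by auto
        then show "Z \<in> comps F ?r'"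
        proof cases
          case 1
          then show ?thesis unfolding comps_def C' using mem[of a] assms(3) by (auto intro!: image_eqI[of _ _ a])
        next
          case 2
          then have "x \<notin> C a \<union> C b" using C_eq unfolding C_def by auto
          then show ?thesis using 2 unfolding comps_def C' by (auto intro!: image_eqI[of _ _ x])
        qed
      qed
    qed
    \<comment> \<open>An old component equal to the union would contain \<open>a\<close>, hence be
      \<open>C a\<close> itself, which has been removed.\<close>
    have notin: "C a \<union> C b \<notin> C ` F - {C a, C b}"
    proof
      assume "C a \<union> C b \<in> C ` F - {C a, C b}"
      then obtain x where x: "C a \<union> C b = C x" "C x \<noteq> C a" by auto
      then have "a \<in> C x" using mem[of a] by auto
      then show False using C_eq[of x a] x(2) by (simp add: C_def)
    qed
    have "C a \<noteq> C b" using False mem[of b] by (auto simp: C_def)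
    moreover have "C a \<in> C ` F" "C b \<in> C ` F" using assms by auto
    ultimately have "card (C ` F) = card (C ` F - {C a, C b}) + 2"
      using card_Diff_subset[of "{C a, C b}" "C ` F"] card_mono[of "C ` F" "{C a, C b}"] assms(1)
      by simp
    moreover have "card (comps F ?r') = Suc (card (C ` F - {C a, C b}))"
      unfolding new using notin assms(1) by (simp add: card_insert_disjoint)
    ultimately show ?thesis using False by (simp add: old)
  qed
qed

section \<open>Ends of paths and regluing of circles\<close>

lemma card_true_eq_card_false:
  assumes "finite K" and h: "\<And>x. x \<in> K \<Longrightarrow> h x \<in> K \<and> h (h x) = x \<and> \<phi> (h x) = (\<not> \<phi> x)"
  shows "card {x \<in> K. \<phi> x} = card {x \<in> K. \<not> \<phi> x}"
  by (rule bij_betw_same_card[of h], rule bij_betw_byWitness[where f' = h]) (use h in auto)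

text \<open>The path leaving the fixed point \<open>a\<close> of \<open>s\<close> ends in a fixed point of the opposite colour,
  since \<open>f\<close> balances the colours of the whole path and \<open>s\<close> those of its non-fixed points.\<close>
lemma other_end:
  assumes "finite F" and f: "fpf_involution F f"
    and s: "\<And>x. x \<in> F \<Longrightarrow> s x \<in> F \<and> s (s x) = x"
    and \<phi>f: "alternating F f \<phi>" and \<phi>s: "\<And>x. x \<in> F \<Longrightarrow> s x \<noteq> x \<Longrightarrow> \<phi> (s x) = (\<not> \<phi> x)"
    and a: "a \<in> F" "s a = a"
  obtains u where "u \<in> F" "s u = u" "(a, u) \<in> (gem_rel F {f, s})\<^sup>*" "\<phi> u \<noteq> \<phi> a"
    "\<forall>v. (a, v) \<in> (gem_rel F {f, s})\<^sup>* \<longrightarrow> s v = v \<longrightarrow> v = a \<or> v = u"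
proof -
  have f': "f x \<in> F" "f (f x) = x" "f x \<noteq> x" "\<phi> (f x) = (\<not> \<phi> x)" if "x \<in> F" for x
    using f \<phi>f that by (auto simp: fpf_involution_def alternating_def)
  obtain u where u: "\<And>v. (a, v) \<in> (gem_rel F {f, s})\<^sup>* \<Longrightarrow> s v = v \<Longrightarrow> v = a \<or> v = u"
    using at_most_two_fixed_points[of F f s a] f' s a by blast
  define K where "K = {v. (a, v) \<in> (gem_rel F {f, s})\<^sup>*}"
  have KF: "x \<in> F" if "x \<in> K" for x
    using that a f' s unfolding K_def
    by (auto elim!: gem_relE elim: rtrancl_closed[where F = F])
  then have finK: "finite K" using assms(1) by (metis finite_subset subsetI)
  have Kf: "f x \<in> K" "s x \<in> K" if "x \<in> K" for x
    using that KF[OF that] unfolding K_def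
    by (auto intro: rtrancl_into_rtrancl gem_relI)
  define Fix where "Fix = {x \<in> K. s x = x}"
  define Mov where "Mov = {x \<in> K. s x \<noteq> x}"
  have "card {x \<in> K. \<phi> x} = card {x \<in> K. \<not> \<phi> x}"
    by (rule card_true_eq_card_false[of _ f]) (use finK Kf KF f' in auto)
  moreover have "card {x \<in> Mov. \<phi> x} = card {x \<in> Mov. \<not> \<phi> x}"
    by (rule card_true_eq_card_false[of _ s]) (use finK Kf KF s \<phi>s in \<open>auto simp: Mov_def\<close>)
  moreover have "card {x \<in> K. P x} = card {x \<in> Fix. P x} + card {x \<in> Mov. P x}" for P
  proof -
    have "{x \<in> K. P x} = {x \<in> Fix. P x} \<union> {x \<in> Mov. P x}" by (auto simp: Fix_def Mov_def)
    then show ?thesis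
      using finK by (simp add: Fix_def Mov_def card_Un_disjoint disjoint_iff)
  qed
  ultimately have bal: "card {x \<in> Fix. \<phi> x} = card {x \<in> Fix. \<not> \<phi> x}" by simp
  have "a \<in> Fix" using a by (simp add: Fix_def K_def)
  have finFix: "finite Fix" using finK by (simp add: Fix_def)
  \<comment> \<open>If all fixed points had the colour of \<open>a\<close>, balance would leave no
    fixed point at all, not even \<open>a\<close>.\<close>
  have "\<exists>v\<in>Fix. \<phi> v \<noteq> \<phi> a"
  proof (rule ccontr)
    assume "\<not> ?thesis"
    then have "{x \<in> Fix. \<phi> x = \<phi> a} = Fix" "{x \<in> Fix. \<phi> x \<noteq> \<phi> a} = {}" by auto
    then have "card Fix = 0" using bal by (cases "\<phi> a") (simp_all only: simp_thms card.empty)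
    then show False using \<open>a \<in> Fix\<close> finFix by auto
  qed
  then obtain v where v: "v \<in> Fix" "\<phi> v \<noteq> \<phi> a" by blast
  then have "v = u" using u by (auto simp: Fix_def K_def)
  then show ?thesis using that[of u] v u KF by (auto simp: Fix_def K_def)
qed

text \<open>Cutting a system of circles at the four points \<open>a, b, c, d\<close> leaves two paths; which points they
  connect decides how regluing \<open>ab, cd\<close> to \<open>ac, bd\<close> changes the number of circles.\<close>
lemma switch_cases:
  assumes "finite F" and f: "fpf_involution F f" and s: "fpf_involution F s"
    and s': "fpf_involution F s'"
    and D: "{a, b, c, d} \<subseteq> F" "distinct [a, b, c, d]"
    and sD: "s a = b" "s c = d" and s'D: "s' a = c" "s' b = d"
    and off: "\<And>x. x \<in> F \<Longrightarrow> x \<notin> {a, b, c, d} \<Longrightarrow> s' x = s x"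
    and \<phi>f: "alternating F f \<phi>" and \<phi>s: "alternating F s \<phi>"
  defines "s0 \<equiv> \<lambda>x. if x \<in> {a, b, c, d} then x else s x"
  defines "R \<equiv> (gem_rel F {f, s0})\<^sup>*"
  shows "(a, b) \<in> R \<and> (c, d) \<in> R \<and> card (orbits F {f, s}) = Suc (card (orbits F {f, s'}))
    \<or> (a, c) \<in> R \<and> \<phi> a \<noteq> \<phi> c \<and> card (orbits F {f, s'}) = Suc (card (orbits F {f, s}))
    \<or> (a, d) \<in> R \<and> \<phi> a \<noteq> \<phi> d \<and> card (orbits F {f, s'}) = card (orbits F {f, s})"
proof -
  have F: "a \<in> F" "b \<in> F" "c \<in> F" "d \<in> F" using D by auto
  have f': "f x \<in> F" "f (f x) = x" if "x \<in> F" for x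
    using f that by (auto simp: fpf_involution_def)
  have s1: "s x \<in> F" "s (s x) = x" "s x \<noteq> x" "\<phi> (s x) = (\<not> \<phi> x)" if "x \<in> F" for x
    using s \<phi>s that by (auto simp: fpf_involution_def alternating_def)
  have s2: "s' x \<in> F" "s' (s' x) = x" "s' x \<noteq> x" if "x \<in> F" for x
    using s' that by (auto simp: fpf_involution_def)
  have sD': "s b = a" "s d = c" "s' c = a" "s' d = b"
    using s1 s2 sD s'D F by metis+
  \<comment> \<open>\<open>s0\<close> is \<open>s\<close> cut open at the four points, which become
    its only fixed points, so \<open>other_end\<close> applies at each of them.\<close>
  have s0: "s0 x \<in> F \<and> s0 (s0 x) = x" if "x \<in> F" for x
  proof (cases "x \<in> {a, b, c, d}")
    case False
    then have "s x \<notin> {a, b, c, d}" using s1[OF that] sD sD' by auto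
    then show ?thesis using False s1[OF that] by (simp add: s0_def)
  qed (use that in \<open>simp add: s0_def\<close>)
  have fix0: "s0 x = x \<longleftrightarrow> x \<in> {a, b, c, d}" if "x \<in> F" for x
    using s1[OF that] by (simp add: s0_def)
  have \<phi>0: "\<phi> (s0 x) = (\<not> \<phi> x)" if "x \<in> F" "s0 x \<noteq> x" for x
    using s1[OF that(1)] that by (simp add: s0_def split: if_splits)
  define r where "r = gem_rel F {f, s0}"
  have Rr: "R = r\<^sup>*" by (simp add: R_def r_def)
  have symr: "sym r" unfolding r_def by (rule sym_gem_rel) (use f' s0 in auto)
  have symR: "(y, x) \<in> R" if "(x, y) \<in> R" for x y
    using that symr unfolding Rr by (metis rtrancl_symD)
  have transR: "(x, z) \<in> R" if "(x, y) \<in> R" "(y, z) \<in> R" for x y z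
    using that unfolding Rr by (rule rtrancl_trans)
  have pair: "\<exists>v\<in>{a, b, c, d}. (u, v) \<in> R \<and> \<phi> v \<noteq> \<phi> u \<and> (\<forall>w\<in>{a, b, c, d}. (u, w) \<in> R \<longrightarrow> w = u \<or> w = v)"
    if "u \<in> {a, b, c, d}" for u
  proof -
    have u: "u \<in> F" "s0 u = u" using that D(1) by (auto simp: s0_def)
    obtain v where "v \<in> F" "s0 v = v" "(u, v) \<in> R" "\<phi> v \<noteq> \<phi> u"
      "\<forall>w. (u, w) \<in> R \<longrightarrow> s0 w = w \<longrightarrow> w = u \<or> w = v"
      by (rule other_end[OF assms(1) f s0 \<phi>f \<phi>0 u, folded R_def])
    then show ?thesis using fix0 D(1) by (intro bexI[of _ v]) auto
  qed
  \<comment> \<open>Regluing adds two links to the cut system; \<open>h\<close> stands for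
    \<open>s\<close> as well as for \<open>s'\<close>.\<close>
  have glue: "card (orbits F {f, h}) = card (comps F (r \<union> {(a, x), (x, a)} \<union> {(y, z), (z, y)}))"
    if h: "h a = x" "h x = a" "h y = z" "h z = y" "{a, x, y, z} = {a, b, c, d}"
      and off: "\<And>v. v \<in> F \<Longrightarrow> v \<notin> {a, b, c, d} \<Longrightarrow> h v = s v" for h x y z
  proof -
    let ?q = "r \<union> {(a, x), (x, a)} \<union> {(y, z), (z, y)}"
    have "gem_rel F {f, h} \<subseteq> ?q"
    proof
      fix e assume "e \<in> gem_rel F {f, h}"
      then obtain v where v: "v \<in> F" "e = (v, f v) \<or> e = (v, h v)"
        by (auto simp: gem_rel_def)
      then have "e = (v, f v) \<or> e = (v, s0 v) \<or> v \<in> {a, x, y, z} \<and> e = (v, h v)"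
        using off[of v] h(5) by (auto simp: s0_def)
      then show "e \<in> ?q" using v(1) h(1-4) unfolding r_def by (auto intro: gem_relI)
    qed
    moreover have "?q \<subseteq> (gem_rel F {f, h})\<^sup>*"
    proof -
      have "(v, h v) \<in> (gem_rel F {f, h})\<^sup>*" if "v \<in> F" for v
        using that by (intro r_into_rtrancl gem_relI) auto
      moreover have "(v, f v) \<in> (gem_rel F {f, h})\<^sup>*" if "v \<in> F" for v
        using that by (intro r_into_rtrancl gem_relI) auto
      moreover have "(v, s0 v) \<in> (gem_rel F {f, h})\<^sup>*" if "v \<in> F" for v
        using calculation(1)[OF that] off[OF that] by (auto simp: s0_def)
      moreover have "a \<in> F" "x \<in> F" "y \<in> F" "z \<in> F" using h(5) D(1) by auto
      ultimately have "(v, w) \<in> (gem_rel F {f, h})\<^sup>*"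
        if "(v, w) \<in> r \<or> (v, w) \<in> {(a, h a), (x, h x), (y, h y), (z, h z)}" for v w
        using that unfolding r_def by (auto elim!: gem_relE)
      then show ?thesis using h(1-4) by auto
    qed
    ultimately have "(gem_rel F {f, h})\<^sup>* = ?q\<^sup>*"
      by (metis rtrancl_subset)
    then show ?thesis unfolding orbits_eq_comps by (rule arg_cong[OF comps_cong])
  qed
  \<comment> \<open>The links are added one after the other, so whether \<open>y\<close> and
    \<open>z\<close> are already connected is tested with the link between \<open>a\<close> and
    \<open>x\<close> in place.\<close>
  have merged: "card (comps F r) = card (orbits F {f, h}) + (if (a, x) \<in> R then 0 else 1)
      + (if (y, z) \<in> R \<or> (y, a) \<in> R \<and> (x, z) \<in> R \<or> (y, x) \<in> R \<and> (a, z) \<in> R then 0 else 1)"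
    if h: "h a = x" "h x = a" "h y = z" "h z = y" "{a, x, y, z} = {a, b, c, d}"
      and off: "\<And>v. v \<in> F \<Longrightarrow> v \<notin> {a, b, c, d} \<Longrightarrow> h v = s v" for h x y z
  proof -
    let ?q = "r \<union> {(a, x), (x, a)}"
    have xyz: "x \<in> F" "y \<in> F" "z \<in> F" using h(5) D(1) by auto
    have reach: "(y, z) \<in> ?q\<^sup>* \<longleftrightarrow> (y, z) \<in> R \<or> (y, a) \<in> R \<and> (x, z) \<in> R \<or> (y, x) \<in> R \<and> (a, z) \<in> R"
      unfolding Rr by (rule rtrancl_insert_sym[OF symr])
    have glued: "card (orbits F {f, h}) = card (comps F (?q \<union> {(y, z), (z, y)}))"
      by (rule glue[OF h]) (rule off)
    have symq: "sym ?q" using symr by (auto simp: sym_def)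
    have c1: "card (comps F r) = card (comps F ?q) + (if (a, x) \<in> R then 0 else 1)"
      unfolding Rr by (rule card_comps_insert[OF assms(1) symr F(1) xyz(1)])
    have c2: "card (comps F ?q) = card (orbits F {f, h}) + (if (y, z) \<in> ?q\<^sup>* then 0 else 1)"
      unfolding glued by (rule card_comps_insert[OF assms(1) symq xyz(2,3)])
    show ?thesis unfolding c1 c2 reach by (simp only: ac_simps)
  qed
  note ms = merged[of s b c d, OF sD(1) sD'(1) sD(2) sD'(2)]
  note ms' = merged[of s' c b d, OF s'D(1) sD'(3) s'D(2) sD'(4)]
  have m: "card (comps F r) = card (orbits F {f, s}) + (if (a, b) \<in> R then 0 else 1)
      + (if (c, d) \<in> R \<or> (c, a) \<in> R \<and> (b, d) \<in> R \<or> (c, b) \<in> R \<and> (a, d) \<in> R then 0 else 1)"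
    using ms by simp
  have m': "card (comps F r) = card (orbits F {f, s'}) + (if (a, c) \<in> R then 0 else 1)
      + (if (b, d) \<in> R \<or> (b, a) \<in> R \<and> (c, d) \<in> R \<or> (b, c) \<in> R \<and> (a, d) \<in> R then 0 else 1)"
    using ms' off by (simp add: insert_commute)
  have ne: "a \<noteq> b" "a \<noteq> c" "a \<noteq> d" "b \<noteq> c" "b \<noteq> d" "c \<noteq> d" using D(2) by auto
  obtain v where v: "v \<in> {a, b, c, d}" "(a, v) \<in> R" "\<phi> v \<noteq> \<phi> a"
    "\<And>w. w \<in> {a, b, c, d} \<Longrightarrow> (a, w) \<in> R \<Longrightarrow> w = a \<or> w = v"
    using pair[OF insertI1] by blast
  \<comment> \<open>The partner of \<open>a\<close> determines that of the remaining two points.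
    With \<open>b\<close>, \<open>s\<close> closes the paths to two circles and \<open>s'\<close> to
    one; with \<open>c\<close> it is the reverse; with \<open>d\<close> both give one
    circle.\<close>
  then consider "v = b" | "v = c" | "v = d" by auto
  then show ?thesis
  proof cases
    case 1
    have "(a, b) \<in> R" "(a, c) \<notin> R" "(a, d) \<notin> R" using 1 v(2) v(4)[of c] v(4)[of d] ne by auto
    moreover have "(c, d) \<in> R"
      using pair[of c] symR transR calculation by blast
    ultimately show ?thesis using m m' symR[of a b] by simp
  next
    case 2
    have "(a, c) \<in> R" "(a, b) \<notin> R" "(a, d) \<notin> R" using 2 v(2) v(4)[of b] v(4)[of d] ne by auto
    moreover have "(b, d) \<in> R"
      using pair[of b] symR transR calculation by blast
    ultimately show ?thesis using m m' symR[of a c] v(3) 2 by simp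
  next
    case 3
    have "(a, d) \<in> R" "(a, b) \<notin> R" "(a, c) \<notin> R" using 3 v(2) v(4)[of b] v(4)[of c] ne by auto
    moreover have "(b, c) \<in> R"
      using pair[of b] symR transR calculation by blast
    ultimately show ?thesis using m m' symR[of b c] v(3) 3 by simp
  qed
qed

section \<open>Boundary circles of spanning ribbon subgraphs\<close>

locale gem =
  fixes G :: "'a ribbon"
  assumes ribbon: "ribbon_graph G"
begin

text \<open>The orbits of \<open>t1\<close> and \<open>state A\<close> are the boundary components of the spanning ribbon subgraph
  with edge set \<open>A\<close>, up to isolated vertices.\<close>
definition state :: "'a set set \<Rightarrow> 'a \<Rightarrow> 'a" where
  "state A x = (if x \<in> \<Union>A then t0 G x else t2 G x)"

definition circles :: "'a set set \<Rightarrow> nat" where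
  "circles A = card (orbits (flags G) {t1 G, state A})"

lemma finite_flags: "finite (flags G)"
  using ribbon by (simp add: ribbon_graph_def)

lemma t1_fpf: "fpf_involution (flags G) (t1 G)"
  using ribbon by (simp add: ribbon_graph_def)

lemma t_simps:
  assumes "x \<in> flags G"
  shows "t0 G x \<in> flags G" "t1 G x \<in> flags G" "t2 G x \<in> flags G"
    "t0 G (t0 G x) = x" "t1 G (t1 G x) = x" "t2 G (t2 G x) = x"
    "t0 G x \<noteq> x" "t1 G x \<noteq> x" "t2 G x \<noteq> x"
    "t2 G (t0 G x) = t0 G (t2 G x)" "t0 G (t2 G x) \<noteq> x"
  using assms ribbon by (auto simp: ribbon_graph_def fpf_involution_def)

lemma t0_neq_t2:
  assumes "x \<in> flags G"
  shows "t0 G x \<noteq> t2 G x"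
  by (metis assms t_simps(3,4,6,10,11))

section \<open>Edges as sets of four flags\<close>

definition edge_of :: "'a \<Rightarrow> 'a set" where
  "edge_of x = {x, t2 G x, t0 G x, t0 G (t2 G x)}"

lemma edge_of_eq: "x \<in> flags G \<Longrightarrow> y \<in> edge_of x \<Longrightarrow> edge_of y = edge_of x"
  by (auto simp: edge_of_def t_simps)

lemma edge_of_subset: "x \<in> flags G \<Longrightarrow> edge_of x \<subseteq> flags G"
  by (auto simp: edge_of_def t_simps)

text \<open>As \<open>t0\<close> and \<open>t2\<close> commute, an orbit closes up after four
  flags.\<close>

lemma rg_edges_eq: "rg_edges G = edge_of ` flags G"
  unfolding rg_edges_def orbits_def
proof (rule image_cong[OF refl])
  fix x assume x: "x \<in> flags G"
  let ?r = "gem_rel (flags G) {t0 G, t2 G}"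
  have step: "(y, t0 G y) \<in> ?r\<^sup>*" "(y, t2 G y) \<in> ?r\<^sup>*" if "y \<in> flags G" for y
    using that by (auto intro!: r_into_rtrancl gem_relI)
  have "y \<in> edge_of x" if "(x, y) \<in> ?r\<^sup>*" for y
    using that by (rule rtrancl_closed) (use x t_simps in \<open>auto simp: edge_of_def elim!: gem_relE\<close>)
  moreover have "(x, t0 G (t2 G x)) \<in> ?r\<^sup>*"
    using step(2)[OF x] step(1)[OF t_simps(3)[OF x]] by (rule rtrancl_trans)
  then have "(x, y) \<in> ?r\<^sup>*" if "y \<in> edge_of x" for y
    using that step[OF x] by (auto simp: edge_of_def)
  ultimately show "{y. (x, y) \<in> ?r\<^sup>*} = edge_of x" by auto
qed

lemma edge_eq: "e \<in> rg_edges G \<Longrightarrow> x \<in> e \<Longrightarrow> e = edge_of x"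
  using edge_of_eq by (auto simp: rg_edges_eq)

lemma edge_subset: "e \<in> rg_edges G \<Longrightarrow> e \<subseteq> flags G"
  using edge_of_subset by (auto simp: rg_edges_eq)

lemma edge_nonempty:
  assumes "e \<in> rg_edges G"
  obtains x where "x \<in> e"
  using assms by (auto simp: rg_edges_eq edge_of_def)

lemma finite_edges: "finite (rg_edges G)"
  by (simp add: rg_edges_eq finite_flags)

lemma mem_Union_iff:
  assumes "A \<subseteq> rg_edges G" "x \<in> flags G"
  shows "x \<in> \<Union>A \<longleftrightarrow> edge_of x \<in> A"
proof
  assume "x \<in> \<Union>A"
  then show "edge_of x \<in> A" using assms(1) edge_eq by auto
next
  assume "edge_of x \<in> A"
  then show "x \<in> \<Union>A" by (auto simp: edge_of_def)
qed

lemma state_eq: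
  assumes "A \<subseteq> rg_edges G" "x \<in> flags G"
  shows "state A x = (if edge_of x \<in> A then t0 G x else t2 G x)"
  using mem_Union_iff[OF assms] by (simp add: state_def)

lemma edge_of_t:
  assumes "x \<in> flags G"
  shows "edge_of (t0 G x) = edge_of x" "edge_of (t2 G x) = edge_of x"
  by (rule edge_of_eq[OF assms], simp add: edge_of_def)+

lemma state_fpf: "A \<subseteq> rg_edges G \<Longrightarrow> fpf_involution (flags G) (state A)"
  by (simp add: fpf_involution_def state_eq t_simps edge_of_t)

text \<open>This is \<open>switch_cases\<close> at the four flags of \<open>e\<close>, the only
  flags where \<open>state A\<close> and \<open>state B\<close> differ; adding and removing
  \<open>e\<close> are treated alike. In the second case a circle splits and the sides of
  \<open>e\<close> are oriented coherently.\<close>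

lemma circles_switch:
  assumes A: "A \<subseteq> rg_edges G" and B: "B \<subseteq> rg_edges G" and e: "e \<in> rg_edges G" "x \<in> e"
    and AB: "e \<in> A \<longleftrightarrow> e \<notin> B" "A - {e} = B - {e}"
    and \<phi>: "alternating (flags G) (t1 G) \<phi>" "alternating (flags G) (state A) \<phi>"
  shows "circles A = Suc (circles B)
    \<or> (x, state B x) \<in> (gem_rel (flags G) {t1 G, state A})\<^sup>* \<and> \<phi> x \<noteq> \<phi> (state B x)
        \<and> circles B = Suc (circles A)
    \<or> (x, state B (state A x)) \<in> (gem_rel (flags G) {t1 G, state A})\<^sup>*
        \<and> \<phi> x \<noteq> \<phi> (state B (state A x)) \<and> circles B = circles A"
proof -
  have x: "x \<in> flags G" and ex: "e = edge_of x"
    using e edge_subset edge_eq by auto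
  let ?b = "state A x" and ?c = "state B x" and ?d = "state B (state A x)"
  let ?D = "{x, ?b, ?c, ?d}"
  have st: "state A y = (if e \<in> A then t0 G y else t2 G y)" "state B y = (if e \<in> B then t0 G y else t2 G y)"
    if "y \<in> e" for y
    using that edge_eq[OF e(1) that] edge_subset[OF e(1)] state_eq[OF A] state_eq[OF B] by auto
  have "t0 G x \<in> e" "t2 G x \<in> e" "t0 G (t2 G x) \<in> e" by (auto simp: ex edge_of_def)
  note st' = st[OF e(2)] st[OF this(1)] st[OF this(2)] st[OF this(3)]
  have De: "?D = e"
    using AB(1) by (cases "e \<in> A") (auto simp: st' ex edge_of_def t_simps x)
  have dist: "distinct [x, ?b, ?c, ?d]"
    using AB(1) t0_neq_t2[OF x] t_simps[OF x] t_simps[OF t_simps(1)[OF x]] t_simps[OF t_simps(3)[OF x]]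
    by (cases "e \<in> A") (auto simp: st')
  have sc: "state A ?c = ?d"
    using AB(1) by (cases "e \<in> A") (auto simp: st' t_simps x)
  have off: "state B y = state A y" if "y \<in> flags G" "y \<notin> ?D" for y
  proof -
    have "edge_of y \<noteq> e" using that(2) De by (auto simp: edge_of_def)
    then have "edge_of y \<in> A \<longleftrightarrow> edge_of y \<in> B" using AB(2) by auto
    then show ?thesis using that state_eq A B by auto
  qed
  have DF: "?D \<subseteq> flags G" using De edge_subset e by simp
  let ?s0 = "\<lambda>y. if y \<in> ?D then y else state A y"
  \<comment> \<open>Cutting only replaces links by loops, so paths of the cut system are paths along
    the circles of \<open>A\<close>.\<close>
  have "gem_rel (flags G) {t1 G, ?s0} \<subseteq> (gem_rel (flags G) {t1 G, state A})\<^sup>="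
    by (auto simp: mem_gem_rel)
  then have "(gem_rel (flags G) {t1 G, ?s0})\<^sup>* \<subseteq> (gem_rel (flags G) {t1 G, state A})\<^sup>*"
    using rtrancl_mono rtrancl_reflcl by blast
  then show ?thesis
    using switch_cases[OF finite_flags t1_fpf state_fpf[OF A] state_fpf[OF B] DF dist refl sc refl refl off \<phi>]
    unfolding circles_def by blast
qed

lemma state_alternating_exists:
  assumes "A \<subseteq> rg_edges G"
  obtains \<phi> where "alternating (flags G) (t1 G) \<phi>" "alternating (flags G) (state A) \<phi>"
  using alternating_exists[OF t1_fpf state_fpf[OF assms]] by blast

lemma toggle_edge:
  assumes "A \<subseteq> rg_edges G" "e \<in> rg_edges G"
  shows "sym_diff A {e} \<subseteq> rg_edges G" "e \<in> A \<longleftrightarrow> e \<notin> sym_diff A {e}" "A - {e} = sym_diff A {e} - {e}"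
  using assms by auto

lemma circles_toggle_le:
  assumes "A \<subseteq> rg_edges G" "e \<in> rg_edges G"
  shows "circles (sym_diff A {e}) \<le> Suc (circles A)" "circles A \<le> Suc (circles (sym_diff A {e}))"
proof -
  obtain \<phi> where "alternating (flags G) (t1 G) \<phi>" "alternating (flags G) (state A) \<phi>"
    using state_alternating_exists assms(1) by blast
  moreover obtain x where "x \<in> e" using edge_nonempty assms(2) by blast
  ultimately show "circles (sym_diff A {e}) \<le> Suc (circles A)" "circles A \<le> Suc (circles (sym_diff A {e}))"
    using circles_switch[OF assms(1) toggle_edge(1)[OF assms] assms(2) _ toggle_edge(2,3)[OF assms], of x \<phi>]
    by auto
qed

text \<open>An increase leaves only the second case of \<open>circles_switch\<close>, whichever flag
  of \<open>e\<close> it is applied to; so \<open>\<phi>\<close> flips along the new links at all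
  flags of \<open>e\<close>. Elsewhere nothing changes.\<close>

lemma alternating_toggle_if_increase:
  assumes A: "A \<subseteq> rg_edges G" and e: "e \<in> rg_edges G"
    and \<phi>: "alternating (flags G) (t1 G) \<phi>" "alternating (flags G) (state A) \<phi>"
    and inc: "circles A < circles (sym_diff A {e})"
  shows "alternating (flags G) (state (sym_diff A {e})) \<phi>"
  unfolding alternating_def
proof
  fix x assume x: "x \<in> flags G"
  show "\<phi> (state (sym_diff A {e}) x) = (\<not> \<phi> x)"
  proof (cases "x \<in> e")
    case True
    then show ?thesis
      using circles_switch[OF A toggle_edge(1)[OF A e] e True toggle_edge(2,3)[OF A e] \<phi>] inc by auto
  next
    case False
    then have "edge_of x \<noteq> e" by (auto simp: edge_of_def)
    then have "state (sym_diff A {e}) x = state A x"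
      using state_eq[OF A x] state_eq[OF toggle_edge(1)[OF A e] x] by auto
    then show ?thesis using \<phi>(2) x by (simp add: alternating_def)
  qed
qed

text \<open>If \<open>\<phi>\<close> alternates before and after, opposite corners of the edge have
  the same colour. This excludes the third case of \<open>circles_switch\<close>, the only one
  without a change of the count.\<close>

lemma odd_circles_toggle:
  assumes A: "A \<subseteq> rg_edges G" and e: "e \<in> rg_edges G"
    and \<phi>: "alternating (flags G) (t1 G) \<phi>" "alternating (flags G) (state A) \<phi>"
      "alternating (flags G) (state (sym_diff A {e})) \<phi>"
  shows "odd (circles (sym_diff A {e}) + circles A)"
proof -
  let ?B = "sym_diff A {e}"
  obtain x where xe: "x \<in> e" using edge_nonempty e by blast
  then have x: "x \<in> flags G" using edge_subset e by blast
  then have "state A x \<in> flags G"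
    using state_fpf[OF A] by (simp add: fpf_involution_def)
  then have "\<phi> (state ?B (state A x)) = \<phi> x"
    using \<phi> x by (simp add: alternating_def)
  then show ?thesis
    using circles_switch[OF A toggle_edge(1)[OF A e] e xe toggle_edge(2,3)[OF A e] \<phi>(1,2)] by auto
qed

text \<open>Coherence is a condition on \<open>\<phi>\<close> at each edge separately, so one
  orientation serves for every \<open>sym_diff A Z\<close> with \<open>Z \<subseteq> Y\<close>. The
  edges can then be toggled one by one, each changing the parity.\<close>

lemma circles_parity:
  assumes A: "A \<subseteq> rg_edges G" and Y: "Y \<subseteq> rg_edges G"
    and \<phi>: "alternating (flags G) (t1 G) \<phi>" "alternating (flags G) (state A) \<phi>"
    and coh: "\<And>e. e \<in> Y \<Longrightarrow> alternating (flags G) (state (sym_diff A {e})) \<phi>"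
  shows "even (circles (sym_diff A Y) + circles A + card Y)"
proof -
  have sub: "sym_diff A Z \<subseteq> rg_edges G" if "Z \<subseteq> Y" for Z
    using A Y that by auto
  have alt: "alternating (flags G) (state (sym_diff A Z)) \<phi>" if Z: "Z \<subseteq> Y" for Z
    unfolding alternating_def
  proof
    fix x assume x: "x \<in> flags G"
    let ?e = "edge_of x"
    \<comment> \<open>At a flag it only matters whether its own edge has been toggled.\<close>
    have "state (sym_diff A Z) x = (if ?e \<in> Z then state (sym_diff A {?e}) x else state A x)"
      using state_eq[OF sub[OF Z] x] state_eq[OF A x] sub[of "{?e}"] state_eq[OF _ x, of "sym_diff A {?e}"] Z
      by auto
    then show "\<phi> (state (sym_diff A Z) x) = (\<not> \<phi> x)"
      using x Z \<phi>(2) coh[of ?e] by (auto simp: alternating_def)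
  qed
  have "finite Y" using Y finite_edges by (rule finite_subset)
  then show ?thesis
  proof (induction rule: finite_subset_induct'[of Y Y, consumes 1, case_names sub empty insert])
    case sub
    then show ?case by simp
  next
    case empty
    then show ?case by simp
  next
    case (insert e Z)
    have eq: "sym_diff (sym_diff A Z) {e} = sym_diff A (insert e Z)" using insert.hyps by auto
    have "odd (circles (sym_diff (sym_diff A Z) {e}) + circles (sym_diff A Z))"
      using insert.hyps Y eq by (intro odd_circles_toggle[OF sub _ \<phi>(1) alt]) (auto intro: alt)
    moreover have "card (insert e Z) = Suc (card Z)" using insert.hyps by simp
    ultimately show ?case using insert.IH unfolding eq by presburger
  qed
qed

section \<open>Euler genus of partial duals\<close>

lemma euler_genus_partial_dual:
  assumes A: "A \<subseteq> rg_edges G"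
  shows "euler_genus (partial_dual G A) = 2 * int (card (orbits (flags G) {t0 G, t1 G, t2 G}))
    + int (card (rg_edges G)) - int (circles A) - int (circles (rg_edges G - A))"
proof -
  define s where "s = (\<lambda>x. if x \<in> \<Union>A then t2 G x else t0 G x)"
  have co: "s x = state (rg_edges G - A) x" if "x \<in> flags G" for x
    using that A mem_Union_iff[OF A that] by (auto simp: s_def state_eq rg_edges_eq)
  have sA: "(\<lambda>x. if x \<in> \<Union>A then t0 G x else t2 G x) = state A"
    by (auto simp: state_def)
  \<comment> \<open>The vertices of the dual are thus the circles of \<open>A\<close> and its
    boundary components those of the complement, up to isolated vertices, which cancel in the genus;
    edges and components stay.\<close>
  have dual: "partial_dual G A = G\<lparr>t0 := s, t2 := state A\<rparr>"
    unfolding partial_dual_def s_def sA ..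
  have "gem_rel (flags G) {s, state A} = gem_rel (flags G) {t0 G, t2 G}"
    and "gem_rel (flags G) {s, t1 G, state A} = gem_rel (flags G) {t0 G, t1 G, t2 G}"
    by (auto simp: mem_gem_rel s_def state_def split: if_splits)
  moreover from this(1) have "rg_edges (partial_dual G A) = rg_edges G"
    by (simp add: rg_edges_def dual orbits_def)
  moreover have "gem_rel (flags G) {s, t1 G} = gem_rel (flags G) {t1 G, state (rg_edges G - A)}"
    by (auto simp: mem_gem_rel co)
  ultimately show ?thesis
    by (simp add: euler_genus_def n_components_def n_vertices_def n_edges_def n_boundary_def
        dual circles_def orbits_def)
qed

text \<open>Lying in \<open>\<Union>A\<close> is constant on edges, so exchanging \<open>t0\<close>
  and \<open>t2\<close> there respects the axioms. This carries statements about the genus of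
  \<open>G\<close> over to its partial duals.\<close>

lemma partial_dual_ribbon:
  assumes A: "A \<subseteq> rg_edges G"
  shows "ribbon_graph (partial_dual G A)"
  using ribbon mem_Union_iff[OF A]
  by (auto simp: ribbon_graph_def fpf_involution_def partial_dual_def edge_of_t t_simps)

text \<open>Adding the edges one at a time: the number of circles grows by at most one, and drops by one
  whenever two components are joined.\<close>
lemma circles_bound:
  assumes "X \<subseteq> rg_edges G"
  shows "circles X + circles {} \<le> 2 * card (orbits (flags G) {t1 G, t2 G, state X}) + card X"
proof -
  have "finite X" using assms finite_edges by (rule finite_subset)
  then show ?thesis using assms
  proof (induction X)
    case empty
    have "state {} = t2 G" by (auto simp: state_def)
    then show ?case by (simp add: circles_def)
  next
    case (insert e X)
    let ?B = "insert e X"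
    let ?q = "gem_rel (flags G) {t1 G, t2 G, state X}"
    let ?q' = "gem_rel (flags G) {t1 G, t2 G, state ?B}"
    have X: "X \<subseteq> rg_edges G" and B: "?B \<subseteq> rg_edges G" and e: "e \<in> rg_edges G"
      using insert.prems by auto
    obtain x where xe: "x \<in> e" using edge_nonempty e by blast
    have x: "x \<in> flags G" using edge_subset e xe by blast
    have ex: "e = edge_of x" using edge_eq e xe by blast
    \<comment> \<open>Attaching \<open>e\<close> amounts to this one link: the parallel link from
      \<open>t2 G x\<close> to \<open>t0 G (t2 G x)\<close> follows, since \<open>t2\<close> ties
      its ends to those of the first.\<close>
    let ?p = "?q \<union> {(x, t0 G x), (t0 G x, x)}"
    have sX: "state X x = t2 G x" and sB: "state ?B x = t0 G x"
      using state_eq[OF X x] state_eq[OF B x] insert.hyps ex by auto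
    have st: "state ?B y = (if y \<in> e then t0 G y else state X y)" if "y \<in> flags G" for y
      using state_eq[OF X that] state_eq[OF B that] edge_eq[OF e, of y]
      by (auto simp: edge_of_def)
    have symq: "sym ?q" and symq': "sym ?q'"
      by (rule sym_gem_rel; use t_simps state_fpf[OF X] state_fpf[OF B] in \<open>auto simp: fpf_involution_def\<close>)+
    have t2q: "(y, t2 G y) \<in> ?q" "(y, t2 G y) \<in> ?q'" if "y \<in> flags G" for y
      using that by (auto intro: gem_relI)
    have "?q' \<subseteq> ?p\<^sup>*"
    proof
      fix z assume "z \<in> ?q'"
      then obtain y where y: "y \<in> flags G" "z = (y, t1 G y) \<or> z = (y, t2 G y) \<or> z = (y, state ?B y)"
        by (auto simp: gem_rel_def)
      show "z \<in> ?p\<^sup>*"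
      proof (cases "z = (y, t0 G y) \<and> y \<in> e")
        case False
        then have "z \<in> ?q" using y st[OF y(1)] by (auto simp: mem_gem_rel)
        then show ?thesis by auto
      next
        case True
        have "(x, t0 G x) \<in> ?p\<^sup>*" "(t0 G x, x) \<in> ?p\<^sup>*" by auto
        moreover have "(u, t2 G u) \<in> ?p\<^sup>*" if "u \<in> flags G" for u
          using t2q(1)[OF that] by auto
        then have "(t2 G x, x) \<in> ?p\<^sup>*" "(x, t2 G x) \<in> ?p\<^sup>*"
          "(t0 G x, t0 G (t2 G x)) \<in> ?p\<^sup>*" "(t0 G (t2 G x), t0 G x) \<in> ?p\<^sup>*"
          using x t_simps by metis+
        ultimately have "(t2 G x, t0 G (t2 G x)) \<in> ?p\<^sup>*" "(t0 G (t2 G x), t2 G x) \<in> ?p\<^sup>*"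
          by (meson rtrancl_trans)+
        then show ?thesis
          using True \<open>(x, t0 G x) \<in> ?p\<^sup>*\<close> \<open>(t0 G x, x) \<in> ?p\<^sup>*\<close> x
          by (auto simp: ex edge_of_def t_simps)
      qed
    qed
    moreover have "?p \<subseteq> ?q'\<^sup>*"
    proof
      fix z assume z: "z \<in> ?p"
      show "z \<in> ?q'\<^sup>*"
      proof (cases "z \<in> {(x, t0 G x), (t0 G x, x)}")
        case True
        have "(x, t0 G x) \<in> ?q'\<^sup>*" using gem_relI[OF x, of "state ?B"] sB by auto
        then show ?thesis using True rtrancl_symD[OF symq'] by auto
      next
        case False
        then obtain y where y: "y \<in> flags G" "z = (y, t1 G y) \<or> z = (y, t2 G y) \<or> z = (y, state X y)"
          using z by (auto simp: gem_rel_def)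
        have "y \<in> e \<Longrightarrow> state X y = t2 G y"
          using state_eq[OF X y(1)] edge_eq[OF e] insert.hyps by auto
        then have "z \<in> ?q'" using y st[OF y(1)] by (auto simp: mem_gem_rel)
        then show ?thesis by auto
      qed
    qed
    ultimately have "?p\<^sup>* = ?q'\<^sup>*" by (intro subset_antisym rtrancl_subset_rtrancl)
    then have "comps (flags G) ?p = comps (flags G) ?q'" by (rule comps_cong)
    then have "card (comps (flags G) ?q) = card (comps (flags G) ?q') + (if (x, t0 G x) \<in> ?q\<^sup>* then 0 else 1)"
      using card_comps_insert[OF finite_flags symq x t_simps(1)[OF x]] by simp
    then have cc: "card (orbits (flags G) {t1 G, t2 G, state X})
        = card (orbits (flags G) {t1 G, t2 G, state ?B}) + (if (x, t0 G x) \<in> ?q\<^sup>* then 0 else 1)"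
      by (simp add: orbits_eq_comps)
    obtain \<phi> where \<phi>: "alternating (flags G) (t1 G) \<phi>" "alternating (flags G) (state X) \<phi>"
      using state_alternating_exists X by blast
    have "gem_rel (flags G) {t1 G, state X} \<subseteq> ?q" by (auto simp: gem_rel_def)
    then have sub: "(gem_rel (flags G) {t1 G, state X})\<^sup>* \<subseteq> ?q\<^sup>*" by (rule rtrancl_mono)
    have "(t0 G (t2 G x), t0 G x) \<in> ?q\<^sup>*"
      using t2q(1)[of "t0 G (t2 G x)"] x t_simps by (metis r_into_rtrancl)
    moreover have "state ?B (t2 G x) = t0 G (t2 G x)"
      using st[of "t2 G x"] x by (simp add: t_simps ex edge_of_def)
    \<comment> \<open>The third case of \<open>circles_switch\<close> leads to
      \<open>t0 G (t2 G x)\<close>, which \<open>t2\<close> ties to \<open>t0 G x\<close>. So unless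
      the count drops, \<open>x\<close> and \<open>t0 G x\<close> already lie in one
      component.\<close>
    ultimately have "circles X = Suc (circles ?B) \<or> (x, t0 G x) \<in> ?q\<^sup>* \<and> circles ?B \<le> Suc (circles X)"
      using circles_switch[OF X B e xe _ _ \<phi>] insert.hyps sub unfolding sX sB
      by (auto intro: rtrancl_trans)
    then show ?case using cc insert.IH[OF X] insert.hyps by (auto split: if_splits)
  qed
qed

text \<open>This is \<open>circles_bound\<close> for all edges: up to isolated vertices, their
  circles are the boundary components and those of the empty set are the vertices.\<close>

lemma euler_genus_nonneg: "0 \<le> euler_genus G"
proof -
  have "state (rg_edges G) x = t0 G x" if "x \<in> flags G" for x
    using state_eq[OF order_refl that] that by (auto simp: rg_edges_eq)
  then have "gem_rel (flags G) {t1 G, t2 G, state (rg_edges G)} = gem_rel (flags G) {t0 G, t1 G, t2 G}"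
    "gem_rel (flags G) {t1 G, state (rg_edges G)} = gem_rel (flags G) {t0 G, t1 G}"
    by (auto simp: mem_gem_rel)
  moreover have "state {} = t2 G" by (auto simp: state_def)
  ultimately show ?thesis
    using circles_bound[OF order_refl]
    by (simp add: euler_genus_def n_components_def n_vertices_def n_edges_def n_boundary_def
        circles_def orbits_def)
qed

end

section \<open>Gaps\<close>

text \<open>\<open>w\<close> abstracts the genus of the partial dual. If the bound fails first at
  \<open>X\<close>, removing any \<open>e\<close> from \<open>X\<close> goes from at least
  \<open>w A + 3\<close> to at most \<open>w A + 1\<close>, a drop of exactly 2. By
  \<open>descent\<close>, undoing all of \<open>X\<close> keeps the parity, yet it leads back to
  \<open>A\<close>.\<close>

lemma plateau_bound:
  fixes w :: "'e set \<Rightarrow> int"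
  assumes step: "\<And>A e. A \<subseteq> E \<Longrightarrow> e \<in> E \<Longrightarrow> \<bar>w (sym_diff A {e}) - w A\<bar> \<le> 2"
    and descent: "\<And>A Y. A \<subseteq> E \<Longrightarrow> Y \<subseteq> E \<Longrightarrow> (\<And>e. e \<in> Y \<Longrightarrow> w (sym_diff A {e}) = w A - 2)
      \<Longrightarrow> even (w (sym_diff A Y) - w A)"
    and "finite X" "A \<subseteq> E" "X \<subseteq> E" "X \<noteq> {}"
    and "\<And>Y. Y \<subseteq> X \<Longrightarrow> Y \<noteq> {} \<Longrightarrow> odd (w (sym_diff A Y) - w A)"
  shows "w (sym_diff A X) \<le> w A + 1"
  using \<open>finite X\<close> assms(5-)
proof (induction X rule: finite_psubset_induct)
  case (psubset X)
  let ?B = "sym_diff A X"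
  have B: "?B \<subseteq> E" using \<open>A \<subseteq> E\<close> psubset.prems(1) by auto
  have odd: "odd (w ?B - w A)" using psubset.prems by blast
  show ?case
  proof (rule ccontr)
    assume "\<not> ?thesis"
    then have big: "w ?B \<ge> w A + 3" using odd by presburger
    have "w (sym_diff ?B {e}) = w ?B - 2" if e: "e \<in> X" for e
    proof -
      have eq: "sym_diff ?B {e} = sym_diff A (X - {e})" using e by auto
      have "w (sym_diff A (X - {e})) \<le> w A + 1"
      \<comment> \<open>For a singleton \<open>X\<close> the removal gives \<open>A\<close> itself,
        which the induction hypothesis does not cover.\<close>
      proof (cases "X - {e} = {}")
        case True
        then show ?thesis unfolding True by simp
      next
        case False
        then show ?thesis
          by (intro psubset.IH) (use e psubset.prems in auto)
      qed
      then show ?thesis using big step[OF B, of e] e psubset.prems(1) unfolding eq by auto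
    qed
    then have "even (w (sym_diff ?B X) - w ?B)"
      using descent[OF B psubset.prems(1)] by blast
    moreover have "sym_diff ?B X = A" by auto
    ultimately show False using odd by (simp add: even_diff_iff)
  qed
qed

text \<open>Induction on the Hamming distance. The inequalities at \<open>A\<close> and
  \<open>B\<close> let an intermediate set of the right parity replace \<open>A\<close> if its value
  is at most \<open>lo\<close>, and \<open>B\<close> if it is at least \<open>hi\<close>; otherwise
  it is the required \<open>C\<close>.\<close>

lemma intermediate_value:
  fixes w :: "'e set \<Rightarrow> int"
  assumes step: "\<And>A e. A \<subseteq> E \<Longrightarrow> e \<in> E \<Longrightarrow> \<bar>w (sym_diff A {e}) - w A\<bar> \<le> 2"
    and descent: "\<And>A Y. A \<subseteq> E \<Longrightarrow> Y \<subseteq> E \<Longrightarrow> (\<And>e. e \<in> Y \<Longrightarrow> w (sym_diff A {e}) = w A - 2)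
      \<Longrightarrow> even (w (sym_diff A Y) - w A)"
    and "finite E" "A \<subseteq> E" "B \<subseteq> E" "even (w A - lo)" "even (w B - lo)" "even (hi - lo)"
    and "w A \<le> lo" "hi \<le> w B" "lo + 4 \<le> hi"
  shows "\<exists>C\<subseteq>E. lo < w C \<and> w C < hi \<and> even (w C - lo)"
  using assms(4-)
proof (induction "card (sym_diff A B)" arbitrary: A B rule: less_induct)
  case less
  let ?S = "sym_diff A B"
  have S: "?S \<subseteq> E" "finite ?S" using less.prems(1,2) finite_subset[OF _ \<open>finite E\<close>] by auto
  have B: "sym_diff A ?S = B" by auto
  show ?case
  proof (cases "\<exists>Y. Y \<subseteq> ?S \<and> Y \<noteq> {} \<and> Y \<noteq> ?S \<and> even (w (sym_diff A Y) - lo)")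
    case True
    then obtain Y where Y: "Y \<subseteq> ?S" "Y \<noteq> {}" "Y \<noteq> ?S" "even (w (sym_diff A Y) - lo)" by blast
    let ?C = "sym_diff A Y"
    have C: "?C \<subseteq> E" using less.prems(1) S Y by blast
    have "sym_diff A ?C = Y" "sym_diff ?C B = ?S - Y" using Y by auto
    moreover have "card Y < card ?S" using Y S by (simp add: psubset_card_mono psubsetI)
    moreover have "card (?S - Y) < card ?S"
      using Y S by (intro psubset_card_mono) auto
    ultimately have "card (sym_diff A ?C) < card ?S" "card (sym_diff ?C B) < card ?S"
      by (simp_all only:)
    then show ?thesis
      using less.hyps[of A ?C] less.hyps[of ?C B] less.prems C Y(4)
      by (metis linorder_not_less)
  next
    case False
    then have odd: "odd (w (sym_diff A Y) - w A)" if "Y \<subseteq> ?S" "Y \<noteq> {}" "Y \<noteq> ?S" for Y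
    proof -
      have "odd (w (sym_diff A Y) - lo)" using False that by blast
      then show ?thesis using less.prems(3) by (simp add: even_diff_iff)
    qed
    have "A \<noteq> B" using less.prems by auto
    then obtain e where e: "e \<in> ?S" by auto
    let ?C = "sym_diff A (?S - {e})"
    have "w ?C \<le> w A + 1"
    proof (cases "?S - {e} = {}")
      case True
      then show ?thesis unfolding True by simp
    next
      case False
      have "odd (w (sym_diff A Y) - w A)" if "Y \<subseteq> ?S - {e}" "Y \<noteq> {}" for Y
        by (rule odd) (use that e in blast)+
      then show ?thesis
        by (intro plateau_bound[OF step descent _ less.prems(1) _ False]) (use S in auto)
    qed
    moreover have "sym_diff ?C {e} = B" using e by auto
    then have "\<bar>w B - w ?C\<bar> \<le> 2" using step[of ?C e] less.prems(1) S e by auto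
    \<comment> \<open>The value one step before \<open>B\<close> is at most \<open>lo + 1\<close>,
      so \<open>w B \<le> lo + 3\<close>, below \<open>hi\<close>.\<close>
    ultimately show ?thesis using less.prems by linarith
  qed
qed

section \<open>Genus steps and coefficients of the partial-dual polynomial\<close>

context gem
begin

lemma euler_genus_nonneg_dual: "A \<subseteq> rg_edges G \<Longrightarrow> 0 \<le> euler_genus (partial_dual G A)"
  by (rule gem.euler_genus_nonneg) (simp add: gem_def partial_dual_ribbon)

lemma sym_diff_complement:
  assumes "A \<subseteq> rg_edges G" "Y \<subseteq> rg_edges G"
  shows "rg_edges G - sym_diff A Y = sym_diff (rg_edges G - A) Y"
  using assms by auto

text \<open>The circle counts of \<open>A\<close> and of its complement each change by at most
  one.\<close>

lemma genus_step:
  assumes "A \<subseteq> rg_edges G" "e \<in> rg_edges G"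
  shows "\<bar>euler_genus (partial_dual G (sym_diff A {e})) - euler_genus (partial_dual G A)\<bar> \<le> 2"
  using circles_toggle_le[OF assms] circles_toggle_le[of "rg_edges G - A" e] assms
    euler_genus_partial_dual[OF assms(1)] euler_genus_partial_dual[OF toggle_edge(1)[OF assms]]
    sym_diff_complement[of A "{e}"]
  by auto

text \<open>A drop by 2 forces both circle counts up, so each edge of \<open>Y\<close> is coherent
  for \<open>A\<close> and for its complement. By \<open>circles_parity\<close> both counts then
  change by the parity of \<open>card Y\<close>, and their sum by an even number.\<close>

lemma genus_descent:
  assumes A: "A \<subseteq> rg_edges G" and Y: "Y \<subseteq> rg_edges G"
    and down: "\<And>e. e \<in> Y \<Longrightarrow> euler_genus (partial_dual G (sym_diff A {e})) = euler_genus (partial_dual G A) - 2"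
  shows "even (euler_genus (partial_dual G (sym_diff A Y)) - euler_genus (partial_dual G A))"
proof -
  let ?A' = "rg_edges G - A"
  have A': "?A' \<subseteq> rg_edges G" by auto
  have inc: "circles A < circles (sym_diff A {e})" "circles ?A' < circles (sym_diff ?A' {e})" if "e \<in> Y" for e
  proof -
    have e: "e \<in> rg_edges G" using that Y by auto
    have "sym_diff ?A' {e} = rg_edges G - sym_diff A {e}"
      using sym_diff_complement[of A "{e}"] A e by auto
    then show "circles A < circles (sym_diff A {e})" "circles ?A' < circles (sym_diff ?A' {e})"
      using down[OF that] euler_genus_partial_dual[OF A] euler_genus_partial_dual[OF toggle_edge(1)[OF A e]]
        circles_toggle_le(1)[OF A e] circles_toggle_le(1)[OF A' e]
      by auto
  qed
  have parity: "even (circles (sym_diff D Y) + circles D + card Y)"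
    if D: "D \<subseteq> rg_edges G" and inc: "\<And>e. e \<in> Y \<Longrightarrow> circles D < circles (sym_diff D {e})" for D
  proof -
    obtain \<phi> where \<phi>: "alternating (flags G) (t1 G) \<phi>" "alternating (flags G) (state D) \<phi>"
      using state_alternating_exists D by blast
    show ?thesis
      by (rule circles_parity[OF D Y \<phi>])
        (use alternating_toggle_if_increase[OF D _ \<phi> inc] Y in blast)
  qed
  have "sym_diff A Y \<subseteq> rg_edges G" using A Y by auto
  then show ?thesis
    using parity[OF A inc(1)] parity[OF A' inc(2)] sym_diff_complement[OF A Y]
      euler_genus_partial_dual[OF A] euler_genus_partial_dual[of "sym_diff A Y"]
    by simp presburger
qed

lemma coeff_partial_dual_poly:
  "coeff (partial_dual_poly G) n
    = int (card {A \<in> Pow (rg_edges G). euler_genus (partial_dual G A) = int n})"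
proof -
  have "coeff (partial_dual_poly G) n
      = (\<Sum>A\<in>Pow (rg_edges G). if nat (euler_genus (partial_dual G A)) = n then 1 else 0)"
    by (simp add: partial_dual_poly_def coeff_sum)
  \<comment> \<open>Nonnegativity of the genus ensures that \<open>nat\<close> loses
    nothing.\<close>
  also have "\<dots> = (\<Sum>A\<in>Pow (rg_edges G). if euler_genus (partial_dual G A) = int n then 1 else 0)"
    by (rule sum.cong) (use euler_genus_nonneg_dual in force)+
  also have "\<dots> = int (card {A \<in> Pow (rg_edges G). euler_genus (partial_dual G A) = int n})"
    using finite_edges by (simp add: sum.If_cases Int_def)
  finally show ?thesis .
qed

lemma coeff_nonzero_iff:
  "coeff (partial_dual_poly G) n \<noteq> 0 \<longleftrightarrow> (\<exists>A\<subseteq>rg_edges G. euler_genus (partial_dual G A) = int n)"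
  using finite_edges by (auto simp: coeff_partial_dual_poly card_eq_0_iff)

lemma no_parity_gap:
  assumes "coeff (partial_dual_poly G) m \<noteq> 0" "coeff (partial_dual_poly G) n \<noteq> 0"
    and "even (m + n)" "m + 4 \<le> n"
  shows "\<exists>l. m < l \<and> l < n \<and> even (m + l) \<and> coeff (partial_dual_poly G) l \<noteq> 0"
proof -
  let ?w = "\<lambda>A. euler_genus (partial_dual G A)"
  obtain A B where AB: "A \<subseteq> rg_edges G" "?w A = int m" "B \<subseteq> rg_edges G" "?w B = int n"
    using assms(1,2) unfolding coeff_nonzero_iff by blast
  have "\<exists>C\<subseteq>rg_edges G. int m < ?w C \<and> ?w C < int n \<and> even (?w C - int m)"
  proof (rule intermediate_value[where w = ?w and A = A and B = B])
    show "\<bar>?w (sym_diff D {e}) - ?w D\<bar> \<le> 2" if "D \<subseteq> rg_edges G" "e \<in> rg_edges G" for D e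
      using that by (rule genus_step)
    show "even (?w (sym_diff D Y) - ?w D)" if "D \<subseteq> rg_edges G" "Y \<subseteq> rg_edges G"
      "\<And>e. e \<in> Y \<Longrightarrow> ?w (sym_diff D {e}) = ?w D - 2" for D Y
      using that by (rule genus_descent)
  qed (use AB assms(3,4) finite_edges in \<open>simp_all add: add.commute\<close>)
  then obtain C where C: "C \<subseteq> rg_edges G" "int m < ?w C" "?w C < int n" "even (?w C - int m)"
    by blast
  then obtain l where l: "?w C = int l"
    using euler_genus_nonneg_dual nonneg_int_cases by blast
  then have "coeff (partial_dual_poly G) l \<noteq> 0"
    using C(1) unfolding coeff_nonzero_iff by blast
  then show ?thesis using C l by (intro exI[of _ l]) auto
qed

end

section \<open>From parity classes to interpolating parts\<close>

lemma coeff_even_part: "coeff (even_part p) i = coeff p (2 * i)"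
  by (auto simp: even_part_def coeff_sum intro!: coeff_eq_0)

lemma coeff_odd_part: "coeff (odd_part p) i = coeff p (2 * i + 1)"
  by (auto simp: odd_part_def coeff_sum intro!: coeff_eq_0)

text \<open>The offset \<open>r\<close> is 0 for the even part and 1 for the odd part.\<close>

lemma interpolating_if_no_parity_gap:
  assumes coeff: "\<And>i. coeff q i = coeff p (2 * i + r)" and "q \<noteq> 0"
    and gap: "\<And>m n. coeff p m \<noteq> 0 \<Longrightarrow> coeff p n \<noteq> 0 \<Longrightarrow> even (m + n) \<Longrightarrow> m + 4 \<le> n
      \<Longrightarrow> \<exists>l. m < l \<and> l < n \<and> even (m + l) \<and> coeff p l \<noteq> 0"
  shows "interpolating q"
  unfolding interpolating_def
proof (intro conjI notI)
  assume "\<exists>i k. has_gap q i k"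
  then obtain i k where ik: "1 \<le> k" "1 \<le> i" "coeff q (i - 1) \<noteq> 0" "coeff q (i + k) \<noteq> 0"
    and zero: "\<And>j. i \<le> j \<Longrightarrow> j < i + k \<Longrightarrow> coeff q j = 0"
    by (auto simp: has_gap_def)
  \<comment> \<open>The ends of the gap are \<open>2 * (k + 1)\<close> apart in \<open>p\<close>,
    which is at least 4 as \<open>k \<ge> 1\<close>.\<close>
  have "\<exists>l. 2 * (i - 1) + r < l \<and> l < 2 * (i + k) + r \<and> even (2 * (i - 1) + r + l) \<and> coeff p l \<noteq> 0"
    by (rule gap) (use ik coeff in auto)
  then obtain l where l: "2 * (i - 1) + r < l" "l < 2 * (i + k) + r" "even (r + l)" "coeff p l \<noteq> 0"
    by auto
  define j where "j = (l - r) div 2"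
  have "l = 2 * j + r" using l(1,3) unfolding j_def by presburger
  then show False using zero[of j] l coeff[of j] by auto
qed (use assms in auto)

theorem theorem2:
  fixes G :: "'a ribbon"
  assumes "ribbon_graph G"
  shows "even_poly (partial_dual_poly G) \<or> odd_poly (partial_dual_poly G)
    \<or> (even_interpolating (partial_dual_poly G) \<and> odd_interpolating (partial_dual_poly G))"
proof -
  interpret gem G by (rule gem.intro[OF assms])
  let ?p = "partial_dual_poly G"
  \<comment> \<open>Failing to be odd supplies the nonzero even coefficient that keeps the even part
    from vanishing; the other parity is handled in the same way.\<close>
  have "even_interpolating ?p" if "\<not> odd_poly ?p"
  proof -
    from that obtain n where "even n" "coeff ?p n \<noteq> 0" by (auto simp: odd_poly_def)
    then obtain i where "coeff ?p (2 * i) \<noteq> 0" by (auto elim: evenE)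
    then have "even_part ?p \<noteq> 0" by (metis coeff_0 coeff_even_part)
    then show ?thesis
      unfolding even_interpolating_def using no_parity_gap
      by (intro interpolating_if_no_parity_gap[where p = ?p and r = 0]) (auto simp: coeff_even_part)
  qed
  moreover have "odd_interpolating ?p" if "\<not> even_poly ?p"
  proof -
    from that obtain n where "odd n" "coeff ?p n \<noteq> 0" by (auto simp: even_poly_def)
    then obtain i where "coeff ?p (2 * i + 1) \<noteq> 0" by (auto elim: oddE)
    then have "odd_part ?p \<noteq> 0" by (metis coeff_0 coeff_odd_part)
    then show ?thesis
      unfolding odd_interpolating_def using no_parity_gap
      by (intro interpolating_if_no_parity_gap[where p = ?p and r = 1]) (auto simp: coeff_odd_part)
  qed
  ultimately show ?thesis by blast
qed

end
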